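(* Let $c,\gamma\in\mathbf R$, and let $\eta=\eta(z)$, $\xi=\xi(z)$, $z=x-ct$, be a travelling wave solution of the Bernoulli condition for two-dimensional water waves with constant vorticity $\gamma$, i.e. with $'=\mathrm d/\mathrm dz$, \[ -c\xi'+\tfrac12(\xi')^2+(g+\gamma c)\eta+\frac{\gamma\eta\,(-2c(\eta')^2-2\xi'+\gamma\eta)}{2(1+(\eta')^2)}-\frac{(-c\eta'+\eta'\xi')^2}{2(1+(\eta')^2)}=\frac{\sigma}{\rho}\frac{\mathrm d}{\mathrm dz}\left(\frac{\eta'}{\sqrt{1+(\eta')^2}}\right). \] Then \[ \eta\le\frac{c^2}{2g}+\frac{\sigma}{2\rho g}\,\frac{\mathrm d}{\mathrm dz}\left(\frac{\eta'}{\sqrt{1+(\eta')^2}}\right). \] If moreover $|\eta'|$ is bounded, then the average wave height satisfies $\langle\eta\rangle\le\dfrac{c^2}{2g}$, in the presence of arbitrary surface tension $\sigma$.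
   Context: Here $g>0$ is the acceleration due to gravity, $\sigma\ge0$ the constant surface tension, $\rho>0$ the constant density; $\eta$ is the (real-valued) height of the free surface $y=\eta(x-ct)$ and $\xi$ is the (real-valued) pseudo-potential evaluated on the free surface, i.e. $\xi=\varphi|_{y=\eta}$, where the pseudo-potential $\varphi$ is harmonic in the fluid and the fluid velocity is $(\varphi_x-\gamma y,\varphi_y)$. The functions $\eta$ and $\xi$ are smooth enough ($\eta\in C^2$, $\xi\in C^1$) for the equation to make sense. The average is $\langle\eta\rangle=\lim_{L\to\infty}\frac1{2L}\int_{-L}^{L}\eta(z)\,\mathrm dz$ (when it exists). *)

theory Defs
  imports "HOL-Analysis.Analysis"
begin

definition curvature :: "(real \<Rightarrow> real) \<Rightarrow> real \<Rightarrow> real" where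
  "curvature \<eta> = deriv (\<lambda>z. deriv \<eta> z / sqrt (1 + (deriv \<eta> z)\<^sup>2))"

(* The profiles are defined on the whole real line, in the moving variable z = x - c t. *)
definition bernoulli_travelling_wave ::
  "real \<Rightarrow> real \<Rightarrow> real \<Rightarrow> real \<Rightarrow> real \<Rightarrow> (real \<Rightarrow> real) \<Rightarrow> (real \<Rightarrow> real) \<Rightarrow> bool" where
  "bernoulli_travelling_wave g \<sigma> \<rho> \<gamma> c \<eta> \<xi> \<longleftrightarrow>
     (\<forall>z. - c * deriv \<xi> z + (1 / 2) * (deriv \<xi> z)\<^sup>2 + (g + \<gamma> * c) * \<eta> z
        + \<gamma> * \<eta> z * (- 2 * c * (deriv \<eta> z)\<^sup>2 - 2 * deriv \<xi> z + \<gamma> * \<eta> z)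
            / (2 * (1 + (deriv \<eta> z)\<^sup>2))
        - (- c * deriv \<eta> z + deriv \<eta> z * deriv \<xi> z)\<^sup>2 / (2 * (1 + (deriv \<eta> z)\<^sup>2))
        = \<sigma> / \<rho> * curvature \<eta> z)"

definition has_average :: "(real \<Rightarrow> real) \<Rightarrow> real \<Rightarrow> bool" where
  "has_average f m \<longleftrightarrow> ((\<lambda>L. 1 / (2 * L) * integral {- L..L} f) \<longlongrightarrow> m) at_top"

end

theory Submission imports Defs begin

text \<open>
  Put \<open>h = \<eta> - c\<^sup>2 / (2 * g)\<close> and \<open>\<kappa> = curvature \<eta>\<close>. Multiplying the Bernoulli condition
  by \<open>2 * (1 + \<eta>'\<^sup>2)\<close> and completing the square turns it into
  \<open>g * h + (\<xi>' - c - \<gamma> * \<eta>)\<^sup>2 / (2 * (1 + \<eta>'\<^sup>2)) = \<sigma> / \<rho> * \<kappa>\<close>, so that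
  \<open>g * h \<le> \<sigma> / \<rho> * \<kappa>\<close> pointwise (\<open>bernoulli_curvature_bound\<close>). This alone bounds \<open>h\<close> by
  \<open>\<sigma> / (\<rho> * g) * \<kappa>\<close>, which is twice the multiple of the curvature claimed, and therefore too
  weak wherever \<open>\<kappa> > 0\<close>.

  The factor is gained from the profile being a graph over the entire line, which forces
  \<open>h \<le> 0\<close> everywhere (\<open>entire_profile_nonpos\<close>). Suppose \<open>h > 0\<close> at some point, and follow the
  graph from there in a direction in which it does not descend. The inequality makes it convex
  as long as \<open>h > 0\<close>, so it keeps rising, and its curvature is bounded below by a fixed
  positive constant. But the curvature is the derivative of \<open>\<eta>' / sqrt (1 + \<eta>'\<^sup>2)\<close>, the sine of the angle
  of inclination, and a quantity confined to \<open>[-1, 1]\<close> cannot grow linearly forever.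
  For \<open>\<sigma> = 0\<close> the bound \<open>h \<le> 0\<close> is immediate.

  The pointwise estimate follows by the sign of the curvature: where \<open>\<kappa> \<ge> 0\<close> use \<open>h \<le> 0\<close>, and
  where \<open>\<kappa> < 0\<close> halving \<open>\<sigma> / (\<rho> * g) * \<kappa>\<close> only increases it. The bound on the
  average is obtained by integrating \<open>\<eta> \<le> c\<^sup>2 / (2 * g)\<close>.
\<close>

section \<open>Entire profiles whose curvature dominates their height\<close>

text \<open>
  A convex stretch that starts without descending never descends, so the height at its end
  is still positive if it was so at its start. This lets positivity of \<open>h\<close> propagate to the
  right past any presumed first zero.
\<close>

lemma nondecreasing_while_curving_up:
  fixes h p w k :: "real \<Rightarrow> real"
  assumes h: "\<And>z. (h has_real_derivative p z) (at z)"
    and w: "\<And>z. (w has_real_derivative k z) (at z)"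
    and sgn: "\<And>z. sgn (w z) = sgn (p z)"
    and start: "0 \<le> w a" and "a \<le> b"
    and k: "\<And>z. a \<le> z \<Longrightarrow> z < b \<Longrightarrow> 0 \<le> k z"
  shows "h a \<le> h b"
proof -
  have p: "0 \<le> p z" if "a \<le> z" "z < b" for z
  proof -
    have "w a \<le> w z"
    proof (rule DERIV_nonneg_imp_nondecreasing[OF \<open>a \<le> z\<close>])
      show "\<exists>y. (w has_real_derivative y) (at x) \<and> 0 \<le> y" if "a \<le> x" "x \<le> z" for x
        using w[of x] k[of x] that \<open>z < b\<close> by auto
    qed
    then show ?thesis
      using start sgn[of z] by (auto simp: sgn_if split: if_splits)
  qed
  show ?thesis
  proof (cases "a = b")
    case False
    then obtain z where "a < z" "z < b" "h b - h a = (b - a) * p z"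
      using MVT2[of a b h p] h \<open>a \<le> b\<close> by force
    then show ?thesis
      using p[of z] by (smt (verit) mult_nonneg_nonneg)
  qed simp
qed

text \<open>
  The parameter \<open>w\<close> stands for the sine of the inclination. Asking only for its
  sign, its boundedness and its derivative makes the hypotheses invariant under the
  reflection \<open>z \<mapsto> -z\<close> used in the next lemma.
\<close>

lemma not_positive_where_ascending:
  fixes h p w k :: "real \<Rightarrow> real"
  assumes h: "\<And>z. (h has_real_derivative p z) (at z)"
    and w: "\<And>z. (w has_real_derivative k z) (at z)"
    and sgn: "\<And>z. sgn (w z) = sgn (p z)"
    and bound: "\<And>z. \<bar>w z\<bar> \<le> B"
    and "0 < \<alpha>" and k: "\<And>z. \<alpha> * h z \<le> k z"
    and start: "0 \<le> w a"
  shows "h a \<le> 0"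
proof (rule ccontr)
  assume "\<not> h a \<le> 0"
  then have ha: "0 < h a" by simp
  have rise: "h a \<le> h b" if "a \<le> b" "\<And>z. a \<le> z \<Longrightarrow> z < b \<Longrightarrow> 0 < h z" for b
  proof (rule nondecreasing_while_curving_up[OF h w sgn start \<open>a \<le> b\<close>])
    show "0 \<le> k z" if "a \<le> z" "z < b" for z
      using \<open>0 < \<alpha>\<close> \<open>\<And>z. a \<le> z \<Longrightarrow> z < b \<Longrightarrow> 0 < h z\<close>[OF that] k[of z]
      by (smt (verit) mult_pos_pos)
  qed
  have pos: "0 < h b" if "a \<le> b" for b
  proof (rule ccontr)
    assume "\<not> 0 < h b"
    define S where "S = {z \<in> {a..b}. h z \<le> 0}"
    have cont: "continuous_on {a..b} h"
      using h by (meson DERIV_continuous_on has_field_derivative_at_within)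
    have "closed S"
      unfolding S_def by (intro continuous_on_closed_Collect_le cont continuous_intros closed_atLeastAtMost)
    moreover have "b \<in> S" using \<open>\<not> 0 < h b\<close> that by (auto simp: S_def)
    moreover have bdd: "bdd_below S" by (auto simp: S_def intro: bdd_belowI)
    ultimately have inf: "Inf S \<in> S" by (intro closed_contains_Inf) auto
    have "h a \<le> h (Inf S)"
    proof (rule rise)
      show "a \<le> Inf S" using inf by (simp add: S_def)
      show "0 < h z" if "a \<le> z" "z < Inf S" for z
        using cInf_lower[OF _ bdd, of z] that inf by (force simp: S_def)
    qed
    then show False using ha inf by (simp add: S_def)
  qed
  have high: "h a \<le> h b" if "a \<le> b" for b
    by (rule rise) (use that pos in auto)
  define s where "s = \<alpha> * h a"
  have "0 < s" using \<open>0 < \<alpha>\<close> ha by (simp add: s_def)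
  have "0 \<le> B" using bound[of a] by linarith
  \<comment> \<open>The abscissa by which growth at rate \<open>s\<close> has carried \<open>w\<close> past its bound.\<close>
  define b where "b = a + (B + 1) / s"
  have "a \<le> b" using \<open>0 < s\<close> \<open>0 \<le> B\<close> by (simp add: b_def)
  have "w a - s * a \<le> w b - s * b"
  proof (rule DERIV_nonneg_imp_nondecreasing[OF \<open>a \<le> b\<close>])
    fix z assume "a \<le> z" "z \<le> b"
    have "((\<lambda>z. w z - s * z) has_real_derivative k z - s) (at z)"
      by (auto intro!: derivative_eq_intros w)
    moreover have "0 \<le> k z - s"
    proof -
      have "s \<le> \<alpha> * h z"
        unfolding s_def using \<open>0 < \<alpha>\<close> high[OF \<open>a \<le> z\<close>] by (intro mult_left_mono) auto
      then show ?thesis using k[of z] by simp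
    qed
    ultimately show "\<exists>y. ((\<lambda>z. w z - s * z) has_real_derivative y) (at z) \<and> 0 \<le> y" by blast
  qed
  moreover have "s * b = s * a + (B + 1)"
    using \<open>0 < s\<close> by (simp add: b_def field_simps)
  ultimately show False using start bound[of b] by linarith
qed

text \<open>
  If the graph descends at the point in question, then it ascends towards the left, and
  the previous lemma applies to its mirror image.
\<close>

lemma entire_profile_nonpos:
  fixes h p w k :: "real \<Rightarrow> real"
  assumes h: "\<And>z. (h has_real_derivative p z) (at z)"
    and w: "\<And>z. (w has_real_derivative k z) (at z)"
    and sgn: "\<And>z. sgn (w z) = sgn (p z)"
    and bound: "\<And>z. \<bar>w z\<bar> \<le> B"
    and "0 < \<alpha>" and k: "\<And>z. \<alpha> * h z \<le> k z"
  shows "h z \<le> 0"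
proof (cases "0 \<le> w z")
  case True
  then show ?thesis by (rule not_positive_where_ascending[OF h w sgn bound \<open>0 < \<alpha>\<close> k])
next
  case False
  have "((\<lambda>x. h (- x)) has_real_derivative - p (- x)) (at x)" for x
    using h[of "- x"] by (simp add: DERIV_mirror)
  moreover have "((\<lambda>x. - w (- x)) has_real_derivative k (- x)) (at x)" for x
    using DERIV_minus[of "\<lambda>x. w (- x)" "- k (- x)"] w[of "- x"] by (simp add: DERIV_mirror)
  ultimately have "h (- (- z)) \<le> 0"
    by (rule not_positive_where_ascending[where B = B and \<alpha> = \<alpha>])
      (use sgn bound k \<open>0 < \<alpha>\<close> False in \<open>auto simp: sgn_minus\<close>)
  then show ?thesis by simp
qed

section \<open>Curvature and the Bernoulli condition\<close>

lemma has_derivative_sine_of_inclination: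
  assumes "deriv \<eta> differentiable (at z)"
  shows "((\<lambda>z. deriv \<eta> z / sqrt (1 + (deriv \<eta> z)\<^sup>2)) has_real_derivative curvature \<eta> z) (at z)"
proof -
  obtain D where "(deriv \<eta> has_real_derivative D) (at z)"
    using assms real_differentiable_def by blast
  moreover have "0 < 1 + (deriv \<eta> z)\<^sup>2" by (simp add: add_pos_nonneg)
  ultimately have "(\<lambda>z. deriv \<eta> z / sqrt (1 + (deriv \<eta> z)\<^sup>2)) differentiable (at z)"
    unfolding real_differentiable_def
    by (intro exI) (auto intro!: derivative_eq_intros)
  then show ?thesis
    unfolding curvature_def by (simp add: DERIV_deriv_iff_real_differentiable)
qed

lemma abs_sine_of_inclination_le_1: "\<bar>p / sqrt (1 + p\<^sup>2)\<bar> \<le> (1 :: real)"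
proof -
  have "\<bar>p\<bar> \<le> sqrt (1 + p\<^sup>2)" by (rule real_le_rsqrt) simp
  moreover have "0 < sqrt (1 + p\<^sup>2)" by (simp add: add_pos_nonneg)
  ultimately show ?thesis by simp
qed

text \<open>
  The inequality drops half the squared tangential velocity of the fluid
  relative to the wave, \<open>(\<xi>' - c - \<gamma> * \<eta>)\<^sup>2 / (2 * (1 + \<eta>'\<^sup>2))\<close>.
\<close>

lemma bernoulli_curvature_bound:
  assumes "bernoulli_travelling_wave g \<sigma> \<rho> \<gamma> c \<eta> \<xi>" and "0 < g"
  shows "g * (\<eta> z - c\<^sup>2 / (2 * g)) \<le> \<sigma> / \<rho> * curvature \<eta> z"
proof -
  define p q e where "p = deriv \<eta> z" and "q = deriv \<xi> z" and "e = \<eta> z"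
  define n where "n = 1 + p\<^sup>2"
  have "0 < n" by (simp add: n_def add_pos_nonneg)
  have p2: "p\<^sup>2 = n - 1" by (simp add: n_def)
  have sq: "(- c * p + p * q)\<^sup>2 = (n - 1) * (q - c)\<^sup>2"
    unfolding p2[symmetric] by (simp add: power2_eq_square algebra_simps)
  have "\<sigma> / \<rho> * curvature \<eta> z = - c * q + (1 / 2) * q\<^sup>2 + (g + \<gamma> * c) * e
      + \<gamma> * e * (- 2 * c * p\<^sup>2 - 2 * q + \<gamma> * e) / (2 * n) - (- c * p + p * q)\<^sup>2 / (2 * n)"
    using assms(1) unfolding bernoulli_travelling_wave_def p_def q_def e_def n_def by simp
  also have "\<dots> = g * e - c\<^sup>2 / 2 + (q - c - \<gamma> * e)\<^sup>2 / (2 * n)"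
    unfolding sq p2 using \<open>0 < n\<close> by (simp add: field_simps power2_eq_square)
  also have "\<dots> \<ge> g * e - c\<^sup>2 / 2"
    using \<open>0 < n\<close> by simp
  finally show ?thesis
    using \<open>0 < g\<close> by (simp add: e_def right_diff_distrib)
qed

lemma has_average_le:
  assumes "has_average f m" and "continuous_on UNIV f" and "\<And>z. f z \<le> M"
  shows "m \<le> M"
proof (rule tendsto_upperbound)
  show "((\<lambda>L. 1 / (2 * L) * integral {- L..L} f) \<longlongrightarrow> m) at_top"
    using assms(1) by (simp add: has_average_def)
  show "\<forall>\<^sub>F L in at_top. 1 / (2 * L) * integral {- L..L} f \<le> M"
    using eventually_gt_at_top[of 0]
  proof eventually_elim
    case (elim L)
    have "f integrable_on {- L..L}"
      using assms(2) by (intro integrable_continuous_real) (rule continuous_on_subset, auto)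
    then have "integral {- L..L} f \<le> integral {- L..L} (\<lambda>_. M)"
      by (rule integral_le) (use assms(3) in auto)
    then show ?case using elim by (simp add: field_simps)
  qed
qed simp

section \<open>The height bounds\<close>

theorem mainTheorem4:
  fixes g \<sigma> \<rho> c \<gamma> :: real and \<eta> \<xi> :: "real \<Rightarrow> real"
  assumes "g > 0" and "\<sigma> \<ge> 0" and "\<rho> > 0"
    and "\<eta> C1_differentiable_on UNIV" and "deriv \<eta> C1_differentiable_on UNIV"
    and "\<xi> C1_differentiable_on UNIV"
    and "bernoulli_travelling_wave g \<sigma> \<rho> \<gamma> c \<eta> \<xi>"
  shows "(\<forall>z. \<eta> z \<le> c\<^sup>2 / (2 * g) + \<sigma> / (2 * \<rho> * g) * curvature \<eta> z) \<and>
         (bounded (range (deriv \<eta>)) \<longrightarrow> (\<forall>m. has_average \<eta> m \<longrightarrow> m \<le> c\<^sup>2 / (2 * g)))"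
proof -
  have \<eta>: "(\<eta> has_real_derivative deriv \<eta> z) (at z)" for z
    using assms(4) by (simp add: C1_differentiable_on_eq DERIV_deriv_iff_real_differentiable)
  have \<eta>': "deriv \<eta> differentiable (at z)" for z
    using assms(5) by (simp add: C1_differentiable_on_eq)
  note bern = bernoulli_curvature_bound[OF assms(7) \<open>g > 0\<close>]
  have nonpos: "\<eta> z - c\<^sup>2 / (2 * g) \<le> 0" for z
  proof (cases "\<sigma> = 0")
    case True
    then show ?thesis using bern[of z] \<open>g > 0\<close> by (simp add: mult_le_0_iff)
  next
    case False
    then have "0 < \<sigma>" using assms(2) by simp
    show ?thesis
    proof (rule entire_profile_nonpos[where h = "\<lambda>z. \<eta> z - c\<^sup>2 / (2 * g)" and p = "deriv \<eta>"
          and w = "\<lambda>z. deriv \<eta> z / sqrt (1 + (deriv \<eta> z)\<^sup>2)" and k = "curvature \<eta>"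
          and B = 1 and \<alpha> = "g * \<rho> / \<sigma>"])
      show "((\<lambda>z. \<eta> z - c\<^sup>2 / (2 * g)) has_real_derivative deriv \<eta> z) (at z)" for z
        by (auto intro!: derivative_eq_intros \<eta>)
      show "sgn (deriv \<eta> z / sqrt (1 + (deriv \<eta> z)\<^sup>2)) = sgn (deriv \<eta> z)" for z
        by (simp add: sgn_divide add_pos_nonneg)
      show "g * \<rho> / \<sigma> * (\<eta> z - c\<^sup>2 / (2 * g)) \<le> curvature \<eta> z" for z
      proof -
        have "\<rho> / \<sigma> * (g * (\<eta> z - c\<^sup>2 / (2 * g))) \<le> \<rho> / \<sigma> * (\<sigma> / \<rho> * curvature \<eta> z)"
          using \<open>\<rho> > 0\<close> \<open>0 < \<sigma>\<close> by (intro mult_left_mono bern) simp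
        also have "\<dots> = curvature \<eta> z"
          using \<open>\<rho> > 0\<close> \<open>0 < \<sigma>\<close> by simp
        finally show ?thesis by (simp add: mult.commute mult.left_commute)
      qed
      show "0 < g * \<rho> / \<sigma>" using assms(1,3) \<open>0 < \<sigma>\<close> by simp
    qed (use has_derivative_sine_of_inclination[OF \<eta>'] abs_sine_of_inclination_le_1 in auto)
  qed
  have "\<eta> z \<le> c\<^sup>2 / (2 * g) + \<sigma> / (2 * \<rho> * g) * curvature \<eta> z" for z
  proof -
    define h where "h = \<eta> z - c\<^sup>2 / (2 * g)"
    define t where "t = \<sigma> / (2 * \<rho> * g) * curvature \<eta> z"
    have "g * h \<le> g * (2 * t)"
      using bern[of z] assms(1,3) by (simp add: h_def t_def field_simps)
    then have "h \<le> 2 * t" using \<open>g > 0\<close> by simp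
    then have "h \<le> t" using nonpos[of z] by (simp add: h_def)
    then show ?thesis by (simp add: h_def t_def)
  qed
  moreover have "m \<le> c\<^sup>2 / (2 * g)" if "has_average \<eta> m" for m
  proof (rule has_average_le[OF that])
    show "continuous_on UNIV \<eta>" using \<eta> by (meson DERIV_continuous_on has_field_derivative_at_within)
    show "\<eta> z \<le> c\<^sup>2 / (2 * g)" for z using nonpos[of z] by simp
  qed
  ultimately show ?thesis by blast
qed

end
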